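(* Let $\mathcal F$ be a filter on $\omega$. Then the Mathias forcing $\mathbb M_{\mathcal F}$ associated with $\mathcal F$ does not add dominating reals if and only if $\mathcal F$ has the Menger covering property as a subspace of $\mathcal P(\omega)$.
   Context: A filter on $\omega$ is a family $\mathcal F\subset[\omega]^\omega$ (of infinite subsets of $\omega$) that contains all co-finite subsets of $\omega$ and is closed under finite intersections of its elements and under supersets. $\mathcal P(\omega)$ carries the topology of the Cantor space $2^\omega$ via characteristic functions; subsets of it carry the subspace topology. $\mathbb M_{\mathcal F}$ consists of pairs $\langle s,F\rangle$ with $s\in[\omega]^{<\omega}$, $F\in\mathcal F$, and $\max s<\min F$ (no requirement if $s=\emptyset$). A condition $\langle s,F\rangle$ is stronger than $\langle t,G\rangle$ if $F\subset G$, $s$ is an end-extension of $t$, and $s\setminus t\subset G$. A poset $\mathbb P$ adds a dominating real if in some generic extension $V^{\mathbb P}$ there is $x\in\omega^\omega$ such that for every $a\in\omega^\omega\cap V$ we have $a(n)\le x(n)$ for all but finitely many $n$. A topological space $X$ has the Menger covering property (is Menger) if for every sequence $\langle\mathcal U_n: n\in\omega\rangle$ of open covers of $X$ there are finite $\mathcal V_n\subset\mathcal U_n$ ($n\in\omega$) such that $\{\bigcup\mathcal V_n: n\in\omega\}$ covers $X$. *)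

theory Defs
  imports "HOL-Analysis.Analysis"
begin

section \<open>Filters on \<open>\<omega>\<close> and the space \<open>\<P>(\<omega>)\<close>\<close>

definition filter_on_omega :: "nat set set \<Rightarrow> bool" where
  "filter_on_omega F \<longleftrightarrow>
     (\<forall>A\<in>F. infinite A) \<and>
     (\<forall>A. finite (- A) \<longrightarrow> A \<in> F) \<and>
     (\<forall>A\<in>F. \<forall>B\<in>F. A \<inter> B \<in> F) \<and>
     (\<forall>A\<in>F. \<forall>B. A \<subseteq> B \<longrightarrow> B \<in> F)"

definition cantor_space :: "(nat \<Rightarrow> bool) topology" where
  "cantor_space = product_topology (\<lambda>_. discrete_topology UNIV) UNIV"

definition powerset_omega :: "nat set topology" where
  "powerset_omega = pullback_topology UNIV (\<lambda>A n. n \<in> A) cantor_space"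

definition menger_space :: "'a topology \<Rightarrow> bool" where
  "menger_space X \<longleftrightarrow>
     (\<forall>\<U> :: nat \<Rightarrow> 'a set set.
        (\<forall>n. (\<forall>U\<in>\<U> n. openin X U) \<and> topspace X \<subseteq> \<Union> (\<U> n)) \<longrightarrow>
        (\<exists>\<V>. (\<forall>n. finite (\<V> n) \<and> \<V> n \<subseteq> \<U> n) \<and> topspace X \<subseteq> (\<Union>n. \<Union> (\<V> n))))"

section \<open>Forcing\<close>

text \<open>
  HOL has no class of all sets, so the ground model \<open>V\<close> is the HOL universe itself and
  the generic extensions are accessed through names and the forcing relation:
  a statement holds in some generic extension iff some condition forces it.

  As usual, a name is a set of pairs (name, condition). A datatype needs a bound on the size of
  these sets; here names are hereditarily of cardinality at most \<open>\<aleph>\<^sub>0 \<cdot> |P|\<close> (for \<open>P\<close> the type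
  of conditions), the pairs being enumerated by a partial function. Every subset of \<open>\<omega> \<times> \<omega>\<close>
  of a generic extension has such a name (e.g. a nice name).
\<close>

datatype 'p name = Name "nat \<times> 'p \<Rightarrow> ('p name \<times> 'p) option"

primrec entries :: "'p name \<Rightarrow> ('p name \<times> 'p) set" where
  "entries (Name f) = ran f"

definition name_of :: "('p name \<times> 'p) set \<Rightarrow> 'p name" where
  "name_of A = (SOME x. entries x = A)"

lemma entries_name_of:
  assumes "g ` (UNIV :: (nat \<times> 'p) set) = A \<or> A = {}"
  shows "entries (name_of A :: 'p name) = A"
proof -
  have "\<exists>x :: 'p name. entries x = A"
  proof (cases "A = {}")
    case True
    then show ?thesis by (intro exI[of _ "Name (\<lambda>_. None)"]) simp
  next
    case False
    then have A: "A = range g" using assms by simp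
    have "entries (Name (\<lambda>i. Some (g i))) = A"
      unfolding A entries.simps ran_def option.inject by blast
    then show ?thesis by blast
  qed
  then show ?thesis unfolding name_of_def by (rule someI_ex)
qed

lemma entries_name_of_countable:
  assumes "countable A"
  shows "entries (name_of A) = A"
proof (cases "A = {}")
  case True
  then show ?thesis by (simp add: entries_name_of)
next
  case False
  have "(\<lambda>i. from_nat_into A (fst i)) ` (UNIV :: (nat \<times> 'a) set) = range (from_nat_into A)"
    by (auto simp: image_iff)
  also have "\<dots> = A" using False assms by (rule range_from_nat_into)
  finally show ?thesis by (intro entries_name_of disjI1)
qed

lemma wf_entries: "wf {(y, x). \<exists>p. (y, p) \<in> entries (x :: 'p name)}"
proof (rule wfUNIVI)
  fix Q :: "'p name \<Rightarrow> bool" and x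
  assume step: "\<forall>x. (\<forall>y. (y, x) \<in> {(y, x). \<exists>p. (y, p) \<in> entries x} \<longrightarrow> Q y) \<longrightarrow> Q x"
  show "Q x"
  proof (induction x)
    case (Name f)
    have "Q y" if "(y, p) \<in> ran f" for y p
    proof -
      from that obtain i where i: "f i = Some (y, p)" unfolding ran_def by blast
      have "Some (y, p) \<in> range f" unfolding i[symmetric] by (rule rangeI)
      then show ?thesis by (rule Name.IH[of "Some (y, p)" "(y, p)" y]) 
          (simp_all only: prod_set_simps option.set singleton_iff)
    qed
    then have "\<forall>y. (y, Name f) \<in> {(y, x). \<exists>p. (y, p) \<in> entries x} \<longrightarrow> Q y"
      unfolding mem_Collect_eq prod.case entries.simps by blast
    with step[THEN spec, of "Name f"] show ?case by (rule mp)
  qed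
qed

locale forcing_notion =
  fixes P :: "'p set" and le :: "'p \<Rightarrow> 'p \<Rightarrow> bool" and one :: 'p
  assumes le_refl: "p \<in> P \<Longrightarrow> le p p"
    and le_trans: "p \<in> P \<Longrightarrow> q \<in> P \<Longrightarrow> r \<in> P \<Longrightarrow> le p q \<Longrightarrow> le q r \<Longrightarrow> le p r"
    and one_mem: "one \<in> P"
    and le_one: "p \<in> P \<Longrightarrow> le p one"
begin

text \<open>\<open>le p q\<close> means that \<open>p\<close> is stronger than \<open>q\<close>. Entries labelled outside \<open>P\<close> are ignored.\<close>

definition elems :: "'p name \<Rightarrow> ('p name \<times> 'p) set" where
  "elems x = {(y, r) \<in> entries x. r \<in> P}"

definition dense_below :: "'p \<Rightarrow> ('p \<Rightarrow> bool) \<Rightarrow> bool" where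
  "dense_below p D \<longleftrightarrow> (\<forall>q\<in>P. le q p \<longrightarrow> (\<exists>r\<in>P. le r q \<and> D r))"

text \<open>
  A formula of the forcing language is represented by the set of conditions forcing it
  (\<open>\<phi> p\<close> reads ``\<open>p\<close> forces \<open>\<phi>\<close>''). Equality of names is extensionality: every element of either
  name is forced to equal some element of the other.
\<close>

function Eq :: "'p name \<Rightarrow> 'p name \<Rightarrow> 'p \<Rightarrow> bool" where
  "Eq x y p \<longleftrightarrow>
     (\<forall>(u, s)\<in>elems x. \<forall>q\<in>P. le q p \<and> le q s \<longrightarrow>
        (\<exists>r\<in>P. le r q \<and> (\<exists>(v, t)\<in>elems y. le r t \<and> Eq u v r))) \<and>
     (\<forall>(v, t)\<in>elems y. \<forall>q\<in>P. le q p \<and> le q t \<longrightarrow>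
        (\<exists>r\<in>P. le r q \<and> (\<exists>(u, s)\<in>elems x. le r s \<and> Eq u v r)))"
  by pat_completeness (simp only: prod.inject)
termination
proof (relation "inv_image {(y, x). \<exists>p. (y, p) \<in> entries x} fst", goal_cases)
  case 1
  show ?case by (intro wf_inv_image wf_entries)
next
  case (2 x y p a u s q r b v t)
  have "(u, s) \<in> elems x" using 2(1) unfolding 2(2)[symmetric] .
  then have "\<exists>s. (u, s) \<in> entries x" unfolding elems_def by blast
  then show ?case unfolding in_inv_image fst_conv mem_Collect_eq prod.case .
next
  case (3 x y p a v t q r b u s)
  have "(u, s) \<in> elems x" using 3(6) unfolding 3(7)[symmetric] .
  then have "\<exists>s. (u, s) \<in> entries x" unfolding elems_def by blast
  then show ?case unfolding in_inv_image fst_conv mem_Collect_eq prod.case .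
qed

declare Eq.simps [simp del]

definition Mem :: "'p name \<Rightarrow> 'p name \<Rightarrow> 'p \<Rightarrow> bool" where
  "Mem x y p \<longleftrightarrow> dense_below p (\<lambda>q. \<exists>(v, t)\<in>elems y. le q t \<and> Eq x v q)"

definition Conj :: "('p \<Rightarrow> bool) \<Rightarrow> ('p \<Rightarrow> bool) \<Rightarrow> 'p \<Rightarrow> bool" where
  "Conj \<phi> \<psi> p \<longleftrightarrow> \<phi> p \<and> \<psi> p"

definition Imp :: "('p \<Rightarrow> bool) \<Rightarrow> ('p \<Rightarrow> bool) \<Rightarrow> 'p \<Rightarrow> bool" where
  "Imp \<phi> \<psi> p \<longleftrightarrow> (\<forall>q\<in>P. le q p \<longrightarrow> \<phi> q \<longrightarrow> \<psi> q)"

text \<open>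
  The quantifiers range over a family given in the ground model: either all names, or a set
  of ground model objects \<open>i\<close> (natural numbers, represented in \<open>\<phi> i\<close> by their canonical names, or
  ground model functions \<open>\<omega> \<rightarrow> \<omega>\<close>). Thus \<open>\<forall>n \<in> \<omega>\<close> ranges over
  the canonical names of \<open>n\<close>, since \<open>\<omega>\<close> is absolute.
\<close>

definition Forall :: "'i set \<Rightarrow> ('i \<Rightarrow> 'p \<Rightarrow> bool) \<Rightarrow> 'p \<Rightarrow> bool" where
  "Forall I \<phi> p \<longleftrightarrow> (\<forall>i\<in>I. \<phi> i p)"

definition Exists :: "'i set \<Rightarrow> ('i \<Rightarrow> 'p \<Rightarrow> bool) \<Rightarrow> 'p \<Rightarrow> bool" where
  "Exists I \<phi> p \<longleftrightarrow> dense_below p (\<lambda>q. \<exists>i\<in>I. \<phi> i q)"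

text \<open>Canonical names of von Neumann naturals, and names of Kuratowski pairs.\<close>

primrec check :: "nat \<Rightarrow> 'p name" where
  "check 0 = name_of {}"
| "check (Suc n) = name_of (insert (check n, one) (entries (check n)))"

definition upair_name :: "'p name \<Rightarrow> 'p name \<Rightarrow> 'p name" where
  "upair_name x y = name_of {(x, one), (y, one)}"

definition pair_name :: "'p name \<Rightarrow> 'p name \<Rightarrow> 'p name" where
  "pair_name x y = upair_name (upair_name x x) (upair_name x y)"

text \<open>\<open>x : \<omega> \<rightarrow> \<omega>\<close>\<close>

definition Real :: "'p name \<Rightarrow> 'p \<Rightarrow> bool" where
  "Real x = Conj
     (Forall UNIV (\<lambda>z. Imp (Mem z x)
        (Exists UNIV (\<lambda>n. Exists UNIV (\<lambda>m. Eq z (pair_name (check n) (check m)))))))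
     (Forall UNIV (\<lambda>n. Conj
        (Exists UNIV (\<lambda>m. Mem (pair_name (check n) (check m)) x))
        (Forall UNIV (\<lambda>m. Forall UNIV (\<lambda>l.
           Imp (Conj (Mem (pair_name (check n) (check m)) x) (Mem (pair_name (check n) (check l)) x))
             (Eq (check m) (check l)))))))"

text \<open>\<open>a(n) \<le> x(n)\<close> for all but finitely many \<open>n\<close>, where \<open>a\<close> is in the ground model; the comparisons
  \<open>N \<le> n\<close> and \<open>a(n) \<le> m\<close> of natural numbers are absolute and evaluated there.\<close>

definition Dominates :: "'p name \<Rightarrow> (nat \<Rightarrow> nat) \<Rightarrow> 'p \<Rightarrow> bool" where
  "Dominates x a = Exists UNIV (\<lambda>N. Forall {N..} (\<lambda>n.
     Exists {a n..} (\<lambda>m. Mem (pair_name (check n) (check m)) x)))"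

definition adds_dominating_real :: bool where
  "adds_dominating_real \<longleftrightarrow>
     (\<exists>p\<in>P. Exists UNIV (\<lambda>x. Conj (Real x) (Forall UNIV (\<lambda>a. Dominates x a))) p)"

end

section \<open>Mathias forcing\<close>

text \<open>If \<open>s = {}\<close>, the condition \<open>max s < min F\<close> is void.\<close>

definition mathias :: "nat set set \<Rightarrow> (nat set \<times> nat set) set" where
  "mathias \<F> = {(s, F). finite s \<and> F \<in> \<F> \<and> (\<forall>i\<in>s. \<forall>j\<in>F. i < j)}"

definition end_extension :: "nat set \<Rightarrow> nat set \<Rightarrow> bool" where
  "end_extension s t \<longleftrightarrow> t \<subseteq> s \<and> (\<forall>i\<in>t. \<forall>j\<in>s - t. i < j)"

definition mathias_le :: "nat set \<times> nat set \<Rightarrow> nat set \<times> nat set \<Rightarrow> bool" where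
  "mathias_le = (\<lambda>(s, F) (t, G). F \<subseteq> G \<and> end_extension s t \<and> s - t \<subseteq> G)"

lemma forcing_notion_mathias:
  assumes "filter_on_omega \<F>"
  shows "forcing_notion (mathias \<F>) mathias_le ({}, UNIV)"
proof
  have "\<forall>A. finite (- A) \<longrightarrow> A \<in> \<F>"
    using assms unfolding filter_on_omega_def by (elim conjE)
  then have "UNIV \<in> \<F>" by simp
  then show "({}, UNIV) \<in> mathias \<F>" by (simp add: mathias_def)
  show "mathias_le p r" if le: "mathias_le p q" "mathias_le q r" for p q r
  proof -
    obtain s F where p: "p = (s, F)" by (rule prod.exhaust)
    obtain t G where q: "q = (t, G)" by (rule prod.exhaust)
    obtain u H where r: "r = (u, H)" by (rule prod.exhaust)
    have pq: "F \<subseteq> G" "t \<subseteq> s" "\<forall>i\<in>t. \<forall>j\<in>s - t. i < j" "s - t \<subseteq> G"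
      and qr: "G \<subseteq> H" "u \<subseteq> t" "\<forall>i\<in>u. \<forall>j\<in>t - u. i < j" "t - u \<subseteq> H"
      using le unfolding p q r mathias_le_def end_extension_def prod.case by blast+
    have "i < j" if "i \<in> u" "j \<in> s - u" for i j
    proof (cases "j \<in> t")
      case True
      then show ?thesis using that qr(3) by blast
    next
      case False
      then show ?thesis using that pq(3) qr(2) by blast
    qed
    moreover have "s - u \<subseteq> H" using pq(4) qr(1,4) by blast
    ultimately show ?thesis
      unfolding p r mathias_le_def end_extension_def prod.case
      using subset_trans[OF pq(1) qr(1)] subset_trans[OF qr(2) pq(2)] by blast
  qed
  show "mathias_le p p" for p
    by (simp add: mathias_le_def end_extension_def split: prod.split)
  show "mathias_le p ({}, UNIV)" for p
    by (simp add: mathias_le_def end_extension_def split: prod.split)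
qed

end

theory Submission imports Defs begin

text \<open>
  Both sides of the equivalence say the same thing about families of finite subsets of \<open>\<omega>\<close>. Call a
  family \<open>X\<close> of finite sets positive if every member of \<open>\<F>\<close> includes a member of \<open>X\<close>, and consider
  the selection principle that from any sequence of positive families \<open>X\<^sub>n\<close> one can choose finite
  \<open>Y\<^sub>n \<subseteq> X\<^sub>n\<close> with positive union.

  The positive families are the covers of \<open>\<F>\<close> by basic open sets of the form \<open>{A. s \<subseteq> A}\<close>, so
  the Menger property implies the principle. For the converse, \<open>\<F>\<close> includes with \<open>A\<close> the compact set
  of all supersets of \<open>A\<close>; hence for any open cover the finite \<open>s\<close> such that
  \<open>{A \<in> \<F>. s \<subseteq> A}\<close> is finitely covered form a positive family (\<open>positive_finitely_covered\<close>).

  If \<open>X\<^sub>n\<close> refutes the principle and \<open>m\<close> is the generic set, let \<open>x(n)\<close> be the least code of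
  a member of \<open>X\<^sub>n\<close> included in \<open>m - n\<close>. For \<open>a\<close> in the ground model, some \<open>A \<in> \<F>\<close> includes no
  member of any \<open>X\<^sub>n\<close> with code below \<open>a(n)\<close>, and \<open>m - n \<subseteq> A\<close> for large \<open>n\<close>. So \<open>x\<close> dominates \<open>a\<close>.

  Conversely, let \<open>x\<close> be a name that a condition \<open>p\<close> forces to be a real. For a stem \<open>s\<close>, the finite \<open>t\<close> such that some condition
  with stem \<open>s \<union> t\<close> decides \<open>x(n)\<close> form a positive family \<open>X\<^sub>n\<close>. The principle gives
  finitely many \<open>t\<close> for each \<open>n\<close>, hence a bound \<open>f\<^sub>s(n)\<close> of the corresponding values, such that
  every condition below \<open>p\<close> with stem \<open>s\<close> has, for arbitrarily large \<open>n\<close>, an extension forcing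
  \<open>x(n) < f\<^sub>s(n)\<close>. There are only countably many stems, and an \<open>f\<close> that eventually bounds all \<open>f\<^sub>s\<close> is not
  dominated by \<open>x\<close>.

  The forcing relation enters only through \<open>adds_dominating_real_iff\<close>, which replaces a name of a
  real by the relation ``\<open>p\<close> decides \<open>x(n) = m\<close>''.
\<close>

section \<open>Names of reals and decision relations\<close>

context forcing_notion
begin

lemma Eq_refl:
  assumes "p \<in> P"
  shows "Eq x x p"
  using wf_entries assms
proof (induction x arbitrary: p rule: wf_induct_rule)
  case (less x)
  have "Eq u u q" if "(u, s) \<in> elems x" "q \<in> P" for u s q
    using less.IH[of u q] that unfolding elems_def by blast
  then show ?case
    unfolding Eq.simps[of x x] using le_refl by fast
qed

lemma Eq_mono:
  assumes "Eq x y p" "le q p" "p \<in> P" "q \<in> P"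
  shows "Eq x y q"
proof -
  have le: "le r p" if "r \<in> P" "le r q" for r
    using that assms le_trans by blast
  show ?thesis
    using assms(1) unfolding Eq.simps[of x y] using le by fast
qed

lemma dense_below_mono:
  assumes "dense_below p D" "le q p" "p \<in> P" "q \<in> P"
  shows "dense_below q D"
  using assms le_trans unfolding dense_below_def by blast

lemma Mem_mono:
  assumes "Mem x y p" "le q p" "p \<in> P" "q \<in> P"
  shows "Mem x y q"
  using dense_below_mono assms unfolding Mem_def by blast

lemma Mem_entry:
  assumes "(x, t) \<in> entries y" "t \<in> P" "p \<in> P" "le p t"
  shows "Mem x y p"
  unfolding Mem_def dense_below_def
proof (intro ballI impI)
  fix q assume "q \<in> P" "le q p"
  then show "\<exists>r\<in>P. le r q \<and> (\<exists>(v, t)\<in>elems y. le r t \<and> Eq x v r)"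
    using assms le_refl le_trans Eq_refl unfolding elems_def by blast
qed

lemma elems_check: "elems (check n) = {(check i, one) | i. i < n}"
proof -
  have "entries (check n) = (\<lambda>i. (check i, one)) ` {..<n}"
  proof (induction n)
    case (Suc n)
    then show ?case
      by (simp add: entries_name_of_countable lessThan_Suc)
  qed (simp add: entries_name_of_countable)
  then show ?thesis unfolding elems_def using one_mem by auto
qed

lemma elems_upair_name: "elems (upair_name x y) = {(x, one), (y, one)}"
  unfolding elems_def upair_name_def using one_mem
  by (auto simp: entries_name_of_countable)

text \<open>
  On names whose labels are hereditarily \<open>one\<close>, such as canonical names and their pairs, forced
  equality cannot depend on the condition. It is therefore compared with equality in the ground model
  through the relation of being forced equal by some condition.
\<close>

lemma Eq_ones_D:
  assumes "Eq x y p" "p \<in> P"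
  shows "(u, one) \<in> elems x \<Longrightarrow> \<exists>r\<in>P. \<exists>(v, t)\<in>elems y. Eq u v r"
    and "(v, one) \<in> elems y \<Longrightarrow> \<exists>r\<in>P. \<exists>(u, s)\<in>elems x. Eq u v r"
  using assms le_refl le_one unfolding Eq.simps[of x y] by fast+

lemma Eq_check_D:
  assumes "Eq (check m) (check n) p" "p \<in> P"
  shows "m = n"
  using assms
proof (induction m arbitrary: n p rule: less_induct)
  case (less m)
  show ?case
  proof (rule linorder_cases[of m n])
    assume "m < n"
    then have "(check m, one) \<in> elems (check n)" by (auto simp: elems_check)
    from Eq_ones_D(2)[OF less.prems this]
    obtain r i where "r \<in> P" "i < m" "Eq (check i) (check m) r" by (auto simp: elems_check)
    with less.IH show ?thesis by blast
  next
    assume "n < m"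
    then have "(check n, one) \<in> elems (check m)" by (auto simp: elems_check)
    from Eq_ones_D(1)[OF less.prems this]
    obtain r j where "r \<in> P" "j < n" "Eq (check n) (check j) r" by (auto simp: elems_check)
    with less.IH \<open>n < m\<close> show ?thesis by blast
  qed
qed

lemma Eq_upair_name_D:
  assumes "Eq (upair_name a b) (upair_name c d) p" "p \<in> P"
  shows "(\<exists>r\<in>P. Eq a c r) \<or> (\<exists>r\<in>P. Eq a d r)" "(\<exists>r\<in>P. Eq b c r) \<or> (\<exists>r\<in>P. Eq b d r)"
    "(\<exists>r\<in>P. Eq a c r) \<or> (\<exists>r\<in>P. Eq b c r)" "(\<exists>r\<in>P. Eq a d r) \<or> (\<exists>r\<in>P. Eq b d r)"
  using Eq_ones_D(1)[OF assms, of a] Eq_ones_D(1)[OF assms, of b]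
    Eq_ones_D(2)[OF assms, of c] Eq_ones_D(2)[OF assms, of d]
  unfolding elems_upair_name by auto

lemma Eq_pair_name_check_D:
  assumes "Eq (pair_name (check n) (check m)) (pair_name (check k) (check l)) p" "p \<in> P"
  shows "n = k \<and> m = l"
proof -
  have sets: "{a, b} = {c, d}"
    if "\<exists>r\<in>P. Eq (upair_name (check a) (check b)) (upair_name (check c) (check d)) r" for a b c d
  proof -
    from that obtain r where
      r: "Eq (upair_name (check a) (check b)) (upair_name (check c) (check d)) r" "r \<in> P" by blast
    have "a = c \<or> a = d" "b = c \<or> b = d" "a = c \<or> b = c" "a = d \<or> b = d"
      using Eq_upair_name_D[OF r] Eq_check_D by blast+
    then show ?thesis by auto
  qed
  show ?thesis
    using Eq_upair_name_D[OF assms[unfolded pair_name_def]] sets[of n n k k] sets[of n n k l]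
      sets[of n m k k] sets[of n m k l]
    by (auto simp: doubleton_eq_iff)
qed

text \<open>
  A decision relation \<open>D n m\<close> (``decides \<open>x(n) = m\<close>'') is what is left of a name of a real: from
  \<open>D\<close> one obtains the nice name with entries \<open>(n, m)\<close> labelled by the conditions in \<open>D n m\<close>.
\<close>

definition decision_relation :: "'p \<Rightarrow> (nat \<Rightarrow> nat \<Rightarrow> 'p \<Rightarrow> bool) \<Rightarrow> bool" where
  "decision_relation p D \<longleftrightarrow>
     (\<forall>n m. \<forall>q\<in>P. \<forall>r\<in>P. D n m q \<longrightarrow> le r q \<longrightarrow> D n m r) \<and>
     (\<forall>n. dense_below p (\<lambda>q. \<exists>m. D n m q)) \<and>
     (\<forall>n m l. \<forall>q\<in>P. le q p \<longrightarrow> D n m q \<longrightarrow> D n l q \<longrightarrow> m = l)"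

definition decides_dominating :: "'p \<Rightarrow> (nat \<Rightarrow> nat \<Rightarrow> 'p \<Rightarrow> bool) \<Rightarrow> bool" where
  "decides_dominating p D \<longleftrightarrow>
     (\<forall>a :: nat \<Rightarrow> nat. dense_below p (\<lambda>q. \<exists>N. \<forall>n\<ge>N. dense_below q (\<lambda>r. \<exists>m\<ge>a n. D n m r)))"

lemma decision_relation_of_Real:
  assumes p: "p \<in> P" and x: "Real x p"
  shows "decision_relation p (\<lambda>n m q. Mem (pair_name (check n) (check m)) x q)"
proof -
  let ?D = "\<lambda>n m q. Mem (pair_name (check n) (check m)) x q"
  have dense: "dense_below p (\<lambda>q. \<exists>m. ?D n m q)" for n
    using x unfolding Real_def Conj_def Forall_def Exists_def by simp
  have "Eq (check m) (check l) q" if "q \<in> P" "le q p" "?D n m q" "?D n l q" for n m l q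
    using x that unfolding Real_def Conj_def Forall_def Imp_def by simp
  then have "m = l" if "q \<in> P" "le q p" "?D n m q" "?D n l q" for n m l q
    using that Eq_check_D by blast
  then show ?thesis
    unfolding decision_relation_def using dense Mem_mono by blast
qed

lemma nice_name_exists:
  "\<exists>x. entries x = {(pair_name (check n) (check m), q) | n m q. q \<in> P \<and> D n m q}"
proof -
  define A where "A = {(pair_name (check n) (check m), q) | n m q. q \<in> P \<and> D n m q}"
  have "\<exists>g. g ` (UNIV :: (nat \<times> 'p) set) = A" if ne: "A \<noteq> {}"
  proof -
    obtain e where e: "e \<in> A" using ne by blast
    \<comment> \<open>An index that codes no entry repeats the fixed entry \<open>e\<close>.\<close>
    define g where "g = (\<lambda>(i, q). case prod_decode i of (n, m) \<Rightarrow>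
      if q \<in> P \<and> D n m q then (pair_name (check n) (check m), q) else e)"
    have "g iq \<in> A" for iq
      using e unfolding g_def A_def by (auto split: prod.split)
    moreover have "z \<in> range g" if "z \<in> A" for z
    proof -
      from that obtain n m q where z: "z = (pair_name (check n) (check m), q)" "q \<in> P" "D n m q"
        unfolding A_def by blast
      then have "z = g (prod_encode (n, m), q)" by (simp add: g_def)
      then show ?thesis by blast
    qed
    ultimately have "range g = A" by blast
    then show ?thesis by blast
  qed
  then obtain g :: "nat \<times> 'p \<Rightarrow> 'p name \<times> 'p" where "range g = A \<or> A = {}" by blast
  from entries_name_of[OF this] show ?thesis unfolding A_def by (rule exI)
qed

lemma Real_of_decision_relation:
  assumes p: "p \<in> P" and D: "decision_relation p D"
    and x: "entries x = {(pair_name (check n) (check m), q) | n m q. q \<in> P \<and> D n m q}"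
  shows "Real x p"
proof -
  have down: "D n m r" if "D n m q" "le r q" "q \<in> P" "r \<in> P" for n m q r
    using D that unfolding decision_relation_def by blast
  have dense: "dense_below p (\<lambda>q. \<exists>m. D n m q)" for n
    using D unfolding decision_relation_def by blast
  have unique: "m = l" if "D n m q" "D n l q" "q \<in> P" "le q p" for n m l q
    using D that unfolding decision_relation_def by blast
  have intro: "Mem (pair_name (check n) (check m)) x q" if "q \<in> P" "D n m q" for n m q
    by (rule Mem_entry[where t = q]) (use that le_refl x in blast)+
  have elim: "\<exists>r\<in>P. le r q \<and> (\<exists>n m. D n m r \<and> Eq z (pair_name (check n) (check m)) r)"
    if mem: "Mem z x q" and q: "q \<in> P" for z q
  proof -
    obtain r v t where r: "r \<in> P" "le r q" "(v, t) \<in> elems x" "le r t" "Eq z v r"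
      using mem q le_refl unfolding Mem_def dense_below_def by blast
    then obtain n m where "v = pair_name (check n) (check m)" "t \<in> P" "D n m t"
      using x unfolding elems_def by auto
    then show ?thesis using r down by blast
  qed
  have pair: "Exists UNIV (\<lambda>n. Exists UNIV (\<lambda>m. Eq z (pair_name (check n) (check m)))) q"
    if mem: "Mem z x q" and q: "q \<in> P" for z q
    unfolding Exists_def dense_below_def[of q]
  proof (intro ballI impI)
    fix q' assume q': "q' \<in> P" "le q' q"
    obtain r n m where r: "r \<in> P" "le r q'" "Eq z (pair_name (check n) (check m)) r"
      using elim[OF Mem_mono[OF mem q'(2) q q'(1)] q'(1)] by blast
    have "dense_below r (\<lambda>q. \<exists>m\<in>UNIV. Eq z (pair_name (check n) (check m)) q)"
      unfolding dense_below_def using Eq_mono[OF r(3) _ r(1)] le_refl by blast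
    then show "\<exists>r\<in>P. le r q' \<and>
      (\<exists>n\<in>UNIV. dense_below r (\<lambda>q. \<exists>m\<in>UNIV. Eq z (pair_name (check n) (check m)) q))"
      using r by blast
  qed
  have sub: "\<exists>r\<in>P. le r q \<and> D n m r" if mem: "Mem (pair_name (check n) (check m)) x q" "q \<in> P"
    for n m q
    using elim[OF mem] Eq_pair_name_check_D by blast
  \<comment> \<open>The two memberships may be due to different labels, but below a common extension of \<open>q\<close> and
    both labels \<open>D\<close> allows only one value.\<close>
  have func: "Eq (check m) (check l) q"
    if q: "q \<in> P" "le q p" and mem: "Mem (pair_name (check n) (check m)) x q"
      "Mem (pair_name (check n) (check l)) x q" for n m l q
  proof -
    obtain r where r: "r \<in> P" "le r q" "D n m r" using sub[OF mem(1) q(1)] by blast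
    then obtain r' where r': "r' \<in> P" "le r' r" "D n l r'"
      using sub[OF Mem_mono[OF mem(2) r(2) q(1) r(1)] r(1)] by blast
    have "le r' p" using r r' q p le_trans by blast
    then have "m = l" using unique[of n m r' l] down[OF r(3)] r' r(1) by blast
    then show ?thesis using Eq_refl q by simp
  qed
  have tot: "Exists UNIV (\<lambda>m. Mem (pair_name (check n) (check m)) x) p" for n
    using dense[of n] intro unfolding Exists_def dense_below_def by blast
  show ?thesis
    unfolding Real_def Conj_def Forall_def Imp_def using pair func tot by blast
qed

lemma adds_dominating_real_iff:
  "adds_dominating_real \<longleftrightarrow> (\<exists>p\<in>P. \<exists>D. decision_relation p D \<and> decides_dominating p D)"
proof
  assume adds_dominating_real
  then obtain p0 x p where p: "p0 \<in> P" "p \<in> P" "Real x p" "\<And>a. Dominates x a p"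
    unfolding adds_dominating_real_def Exists_def dense_below_def Conj_def Forall_def
    using le_refl by blast
  have "decides_dominating p (\<lambda>n m q. Mem (pair_name (check n) (check m)) x q)"
    using p(4) unfolding Dominates_def Exists_def Forall_def decides_dominating_def
    by (simp add: Bex_def Ball_def)
  then show "\<exists>p\<in>P. \<exists>D. decision_relation p D \<and> decides_dominating p D"
    using decision_relation_of_Real[OF p(2,3)] p(2) by blast
next
  assume "\<exists>p\<in>P. \<exists>D. decision_relation p D \<and> decides_dominating p D"
  then obtain p D where p: "p \<in> P" and D: "decision_relation p D" "decides_dominating p D" by blast
  obtain x where x: "entries x = {(pair_name (check n) (check m), q) | n m q. q \<in> P \<and> D n m q}"
    using nice_name_exists by blast
  have mem: "Mem (pair_name (check n) (check m)) x q" if "q \<in> P" "D n m q" for n m q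
    by (rule Mem_entry[where t = q]) (use that le_refl x in blast)+
  have real: "Real x q" if q: "q \<in> P" "le q p" for q
  proof -
    have "\<forall>n. dense_below p (\<lambda>q. \<exists>m. D n m q)"
      using D(1) unfolding decision_relation_def by (elim conjE)
    then have "\<forall>n. dense_below q (\<lambda>q. \<exists>m. D n m q)"
      using dense_below_mono[OF _ q(2) p q(1)] by blast
    moreover have "\<forall>n m l. \<forall>r\<in>P. le r q \<longrightarrow> D n m r \<longrightarrow> D n l r \<longrightarrow> m = l"
    proof (intro allI ballI impI)
      fix n m l r assume r: "r \<in> P" "le r q" "D n m r" "D n l r"
      have "le r p" using le_trans[of r q p] r(1,2) q p by blast
      then show "m = l" using D(1) r(1,3,4) unfolding decision_relation_def by blast
    qed
    moreover have "\<forall>n m. \<forall>q\<in>P. \<forall>r\<in>P. D n m q \<longrightarrow> le r q \<longrightarrow> D n m r"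
      using D(1) unfolding decision_relation_def by (elim conjE)
    ultimately have "decision_relation q D"
      unfolding decision_relation_def by (intro conjI)
    then show ?thesis by (rule Real_of_decision_relation[OF q(1) _ x])
  qed
  have dom: "Dominates x a q" if q: "q \<in> P" "le q p" for a q
  proof -
    have "dense_below p (\<lambda>q. \<exists>N. \<forall>n\<ge>N. dense_below q (\<lambda>r. \<exists>m\<ge>a n. D n m r))"
      using D(2) unfolding decides_dominating_def by blast
    then have dense: "dense_below q (\<lambda>q. \<exists>N. \<forall>n\<ge>N. dense_below q (\<lambda>r. \<exists>m\<ge>a n. D n m r))"
      using dense_below_mono q p by blast
    have "dense_below r (\<lambda>r. \<exists>m\<in>{a n..}. Mem (pair_name (check n) (check m)) x r)"
      if "dense_below r (\<lambda>r. \<exists>m\<ge>a n. D n m r)" for r n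
      using that mem unfolding dense_below_def by (meson atLeast_iff)
    then show ?thesis
      using dense unfolding Dominates_def Exists_def Forall_def dense_below_def[of q]
      by (meson atLeast_iff UNIV_I)
  qed
  show adds_dominating_real
    unfolding adds_dominating_real_def Exists_def dense_below_def Conj_def Forall_def
    using p real dom le_refl by blast
qed

end

section \<open>Positive families and the Menger property\<close>

lemma filter_superset:
  assumes "filter_on_omega \<F>" "A \<in> \<F>" "A \<subseteq> B"
  shows "B \<in> \<F>"
  using assms unfolding filter_on_omega_def by blast

lemma filter_Int:
  assumes "filter_on_omega \<F>" "A \<in> \<F>" "B \<in> \<F>"
  shows "A \<inter> B \<in> \<F>"
  using assms unfolding filter_on_omega_def by blast

lemma filter_above:
  assumes "filter_on_omega \<F>" "A \<in> \<F>" "finite s"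
  shows "{j \<in> A. \<forall>i\<in>s. i < j} \<in> \<F>"
proof -
  have "- {j. \<forall>i\<in>s. i < j} = (\<Union>i\<in>s. {..i})" by (auto simp: not_less)
  then have "finite (- {j. \<forall>i\<in>s. i < j})" using assms(3) by simp
  moreover have "\<forall>A. finite (- A) \<longrightarrow> A \<in> \<F>"
    using assms(1) unfolding filter_on_omega_def by (elim conjE)
  ultimately have "{j. \<forall>i\<in>s. i < j} \<in> \<F>" by blast
  then have "A \<inter> {j. \<forall>i\<in>s. i < j} \<in> \<F>" using filter_Int assms by blast
  then show ?thesis by (simp add: Int_def)
qed

definition positive :: "'a set set \<Rightarrow> 'a set set \<Rightarrow> bool" where
  "positive \<F> X \<longleftrightarrow> (\<forall>A\<in>\<F>. \<exists>s\<in>X. s \<subseteq> A)"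

definition positive_selection :: "'a set set \<Rightarrow> bool" where
  "positive_selection \<F> \<longleftrightarrow>
     (\<forall>X :: nat \<Rightarrow> 'a set set. (\<forall>n. X n \<subseteq> Collect finite \<and> positive \<F> (X n)) \<longrightarrow>
        (\<exists>Y. (\<forall>n. finite (Y n) \<and> Y n \<subseteq> X n) \<and> positive \<F> (\<Union>n. Y n)))"

lemma positive_mono:
  assumes "positive \<F> X" "X \<subseteq> Y"
  shows "positive \<F> Y"
  using assms unfolding positive_def by blast

lemma topspace_powerset_omega: "topspace powerset_omega = UNIV"
  by (auto simp: powerset_omega_def cantor_space_def topspace_pullback_topology)

lemma topspace_subtopology_powerset_omega: "topspace (subtopology powerset_omega \<F>) = \<F>"
  by (simp add: topspace_powerset_omega)

lemma openin_powerset_omega_contains: "openin powerset_omega {A. i \<in> A}"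
  and openin_powerset_omega_avoids: "openin powerset_omega {A. i \<notin> A}"
proof -
  have cont: "continuous_map powerset_omega (discrete_topology UNIV) (\<lambda>A. i \<in> A)"
  proof -
    have "continuous_map cantor_space (discrete_topology UNIV) (\<lambda>x. x i)"
      unfolding cantor_space_def by (rule continuous_map_product_projection) simp
    then have "continuous_map powerset_omega (discrete_topology UNIV) ((\<lambda>x. x i) \<circ> (\<lambda>A n. n \<in> A))"
      unfolding powerset_omega_def by (rule continuous_map_pullback)
    then show ?thesis by (simp add: o_def)
  qed
  show "openin powerset_omega {A. i \<in> A}" "openin powerset_omega {A. i \<notin> A}"
    using openin_continuous_map_preimage[OF cont, of "{True}"]
      openin_continuous_map_preimage[OF cont, of "{False}"] by (simp_all add: topspace_powerset_omega)
qed

lemma openin_powerset_omega_superset: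
  assumes "finite s"
  shows "openin powerset_omega {A. s \<subseteq> A}"
proof (cases "s = {}")
  case True
  then show ?thesis using openin_topspace[of powerset_omega] by (simp add: topspace_powerset_omega)
next
  case False
  have "{A. s \<subseteq> A} = (\<Inter>i\<in>s. {A. i \<in> A})" by blast
  then show ?thesis
    using assms False openin_powerset_omega_contains by (auto intro!: openin_Inter)
qed

lemma compact_space_powerset_omega: "compact_space powerset_omega"
proof -
  have "compact_space cantor_space"
    unfolding cantor_space_def 
    by (simp add: compact_space_product_topology compact_space_discrete_topology)
  moreover have "continuous_map cantor_space powerset_omega Collect"
    unfolding powerset_omega_def by (rule continuous_map_pullback') (simp_all add: o_def)
  ultimately have "compactin powerset_omega (Collect ` topspace cantor_space)"
    using image_compactin[of cantor_space] unfolding compact_space_def by blast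
  moreover have "Collect ` topspace cantor_space = topspace powerset_omega"
    unfolding topspace_powerset_omega by (simp add: cantor_space_def surj_def) (metis Collect_mem_eq)
  ultimately show ?thesis by (simp add: compact_space_def)
qed

text \<open>
  The supersets of a given \<open>A \<in> \<F>\<close> form a compact subset of \<open>\<F>\<close>, and even finitely many elements of
  \<open>A\<close> suffice to enforce membership in a finite part of the cover: together with the sets
  \<open>{B. i \<notin> B}\<close> for \<open>i \<in> A\<close>, the cover of \<open>\<F>\<close> covers the whole compact space.
\<close>

lemma positive_finitely_covered:
  assumes \<F>: "filter_on_omega \<F>"
    and op: "\<And>U. U \<in> \<U> \<Longrightarrow> openin (subtopology powerset_omega \<F>) U"
    and cov: "\<F> \<subseteq> \<Union> \<U>"
  shows "positive \<F> {s. finite s \<and> (\<exists>\<V>. finite \<V> \<and> \<V> \<subseteq> \<U> \<and> {B \<in> \<F>. s \<subseteq> B} \<subseteq> \<Union> \<V>)}"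
  unfolding positive_def
proof
  fix A assume A: "A \<in> \<F>"
  have "\<exists>W. openin powerset_omega W \<and> U = W \<inter> \<F>" if "U \<in> \<U>" for U
    using op[OF that] by (simp add: openin_subtopology)
  then obtain W where W: "\<And>U. U \<in> \<U> \<Longrightarrow> openin powerset_omega (W U) \<and> U = W U \<inter> \<F>" by metis
  define \<C> where "\<C> = W ` \<U> \<union> (\<lambda>i. {B. i \<notin> B}) ` A"
  have "B \<in> \<Union> \<C>" for B
  proof (cases "A \<subseteq> B")
    case True
    then have "B \<in> \<Union> \<U>" using filter_superset[OF \<F> A] cov by blast
    then show ?thesis using W unfolding \<C>_def by blast
  qed (auto simp: \<C>_def)
  moreover have "openin powerset_omega C" if "C \<in> \<C>" for C
    using that W openin_powerset_omega_avoids unfolding \<C>_def by blast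
  ultimately obtain \<D> where \<D>: "finite \<D>" "\<D> \<subseteq> \<C>" "UNIV \<subseteq> \<Union> \<D>"
    using compact_space_powerset_omega
    unfolding compact_space_def compactin_def topspace_powerset_omega by (metis subsetI)
  obtain \<V> s where \<V>: "finite \<V>" "\<V> \<subseteq> \<U>" "finite s" "s \<subseteq> A" "\<D> = W ` \<V> \<union> (\<lambda>i. {B. i \<notin> B}) ` s"
  proof -
    obtain D1 D2 where "\<D> = D1 \<union> D2" "D1 \<subseteq> W ` \<U>" "D2 \<subseteq> (\<lambda>i. {B. i \<notin> B}) ` A"
      using \<D>(2) unfolding \<C>_def by (metis subset_UnE)
    moreover from this have "finite D1" "finite D2" using \<D>(1) by auto
    ultimately obtain \<V> s where "finite \<V>" "\<V> \<subseteq> \<U>" "D1 = W ` \<V>"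
      "finite s" "s \<subseteq> A" "D2 = (\<lambda>i. {B. i \<notin> B}) ` s"
      using finite_subset_image[of D1 W \<U>] finite_subset_image[of D2 _ A] by metis
    then show thesis using that \<open>\<D> = D1 \<union> D2\<close> by blast
  qed
  have "B \<in> \<Union> \<V>" if B: "B \<in> \<F>" "s \<subseteq> B" for B
  proof -
    have "B \<in> \<Union> \<D>" using \<D>(3) by blast
    then obtain U where "U \<in> \<V>" "B \<in> W U" using B(2) unfolding \<V>(5) by blast
    then show ?thesis using W[of U] \<V>(2) B(1) by blast
  qed
  then show "\<exists>s\<in>{s. finite s \<and> (\<exists>\<V>. finite \<V> \<and> \<V> \<subseteq> \<U> \<and> {B \<in> \<F>. s \<subseteq> B} \<subseteq> \<Union> \<V>)}. s \<subseteq> A"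
    using \<V> by blast
qed

lemma menger_space_iff_positive_selection:
  assumes \<F>: "filter_on_omega \<F>"
  shows "menger_space (subtopology powerset_omega \<F>) \<longleftrightarrow> positive_selection \<F>"
proof
  assume menger: "menger_space (subtopology powerset_omega \<F>)"
  show "positive_selection \<F>"
    unfolding positive_selection_def
  proof (intro allI impI)
    fix X :: "nat \<Rightarrow> nat set set"
    assume X: "\<forall>n. X n \<subseteq> Collect finite \<and> positive \<F> (X n)"
    define basic where "basic s = \<F> \<inter> {A. s \<subseteq> A}" for s :: "nat set"
    have "openin (subtopology powerset_omega \<F>) U" if U: "U \<in> basic ` X n" for U n
    proof -
      obtain s where s: "s \<in> X n" "U = {A. s \<subseteq> A} \<inter> \<F>" using U unfolding basic_def by blast
      then have "openin powerset_omega {A. s \<subseteq> A}"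
        using X openin_powerset_omega_superset by blast
      then show ?thesis unfolding s(2) openin_subtopology by blast
    qed
    moreover have "\<F> \<subseteq> \<Union> (basic ` X n)" for n
    proof
      fix A assume "A \<in> \<F>"
      then obtain s where "s \<in> X n" "s \<subseteq> A" using X unfolding positive_def by blast
      then show "A \<in> \<Union> (basic ` X n)" using \<open>A \<in> \<F>\<close> unfolding basic_def by auto
    qed
    ultimately have "\<forall>n. (\<forall>U\<in>basic ` X n. openin (subtopology powerset_omega \<F>) U) \<and>
        \<F> \<subseteq> \<Union> (basic ` X n)"
      by (intro allI conjI ballI)
    then have "\<exists>\<V>. (\<forall>n. finite (\<V> n) \<and> \<V> n \<subseteq> basic ` X n) \<and> \<F> \<subseteq> (\<Union>n. \<Union> (\<V> n))"
      by (rule menger[unfolded menger_space_def topspace_subtopology_powerset_omega, THEN spec, THEN mp])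
    then obtain \<V> where
      "(\<forall>n. finite (\<V> n) \<and> \<V> n \<subseteq> basic ` X n) \<and> \<F> \<subseteq> (\<Union>n. \<Union> (\<V> n))" ..
    then have \<V>: "\<forall>n. finite (\<V> n) \<and> \<V> n \<subseteq> basic ` X n" "\<F> \<subseteq> (\<Union>n. \<Union> (\<V> n))"
      by simp_all
    have "\<exists>Y. finite Y \<and> Y \<subseteq> X n \<and> \<V> n = basic ` Y" for n
      using finite_subset_image[of "\<V> n" basic "X n"] \<V>(1) by metis
    then obtain Y where Y: "\<And>n. finite (Y n) \<and> Y n \<subseteq> X n \<and> \<V> n = basic ` Y n" by metis
    have "positive \<F> (\<Union>n. Y n)"
      unfolding positive_def
    proof
      fix A assume "A \<in> \<F>"
      then obtain n U where "U \<in> \<V> n" "A \<in> U" using \<V>(2) by blast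
      then obtain s where "s \<in> Y n" "A \<in> basic s" using Y[of n] by auto
      then show "\<exists>s\<in>\<Union>n. Y n. s \<subseteq> A" unfolding basic_def by blast
    qed
    then show "\<exists>Y. (\<forall>n. finite (Y n) \<and> Y n \<subseteq> X n) \<and> positive \<F> (\<Union>n. Y n)"
      using Y by blast
  qed
next
  assume sel: "positive_selection \<F>"
  show "menger_space (subtopology powerset_omega \<F>)"
    unfolding menger_space_def topspace_subtopology_powerset_omega
  proof (intro allI impI)
    fix \<U> :: "nat \<Rightarrow> nat set set set"
    assume \<U>: "\<forall>n. (\<forall>U\<in>\<U> n. openin (subtopology powerset_omega \<F>) U) \<and> \<F> \<subseteq> \<Union> (\<U> n)"
    define X where
      "X n = {s. finite s \<and> (\<exists>\<V>. finite \<V> \<and> \<V> \<subseteq> \<U> n \<and> {B \<in> \<F>. s \<subseteq> B} \<subseteq> \<Union> \<V>)}" for n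
    have "positive \<F> (X n)" for n
      unfolding X_def by (rule positive_finitely_covered[OF \<F>]) (use \<U> in blast)+
    moreover have "X n \<subseteq> Collect finite" for n unfolding X_def by blast
    ultimately obtain Y where Y: "\<And>n. finite (Y n)" "\<And>n. Y n \<subseteq> X n" "positive \<F> (\<Union>n. Y n)"
      using sel unfolding positive_selection_def by metis
    define V where
      "V n s = (SOME \<V>. finite \<V> \<and> \<V> \<subseteq> \<U> n \<and> {B \<in> \<F>. s \<subseteq> B} \<subseteq> \<Union> \<V>)" for n s
    have V: "finite (V n s) \<and> V n s \<subseteq> \<U> n \<and> {B \<in> \<F>. s \<subseteq> B} \<subseteq> \<Union> (V n s)"
      if "s \<in> Y n" for n s
      unfolding V_def by (rule someI_ex) (use Y(2)[of n] that X_def in blast)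
    have "finite (\<Union>s\<in>Y n. V n s) \<and> (\<Union>s\<in>Y n. V n s) \<subseteq> \<U> n" for n
      using V Y(1)[of n] by (intro conjI finite_UN_I UN_least) blast+
    moreover have "\<F> \<subseteq> (\<Union>n. \<Union> (\<Union>s\<in>Y n. V n s))"
    proof
      fix B assume "B \<in> \<F>"
      then obtain n s where "s \<in> Y n" "s \<subseteq> B" using Y(3) unfolding positive_def by blast
      then show "B \<in> (\<Union>n. \<Union> (\<Union>s\<in>Y n. V n s))" using V[of s n] \<open>B \<in> \<F>\<close> by blast
    qed
    ultimately show "\<exists>\<V>. (\<forall>n. finite (\<V> n) \<and> \<V> n \<subseteq> \<U> n) \<and> \<F> \<subseteq> (\<Union>n. \<Union> (\<V> n))"
      by (intro exI[of _ "\<lambda>n. \<Union>s\<in>Y n. V n s"] conjI allI) blast+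
  qed
qed

text \<open>
  Applying the principle to every tail of the sequence separately makes the selected sets positive
  on every tail; only finitely many of these selections concern a given index.
\<close>

lemma positive_selection_tails:
  assumes sel: "positive_selection \<F>"
    and X: "\<And>n :: nat. X n \<subseteq> Collect finite" "\<And>n. positive \<F> (X n)"
  obtains Y where "\<And>n. finite (Y n)" "\<And>n. Y n \<subseteq> X n" "\<And>N. positive \<F> (\<Union>n\<in>{N..}. Y n)"
proof -
  have "\<exists>Y. (\<forall>n. finite (Y n) \<and> Y n \<subseteq> X (n + N)) \<and> positive \<F> (\<Union>n. Y n)" for N
    using sel[unfolded positive_selection_def, rule_format, of "\<lambda>n. X (n + N)"] X by blast
  then obtain Z where Z: "\<And>N n. finite (Z N n)" "\<And>N n. Z N n \<subseteq> X (n + N)"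
    "\<And>N. positive \<F> (\<Union>n. Z N n)" by metis
  define Y where "Y n = (\<Union>N\<in>{..n}. Z N (n - N))" for n
  show thesis
  proof
    show "finite (Y n)" for n unfolding Y_def using Z(1) by blast
    show "Y n \<subseteq> X n" for n unfolding Y_def using Z(2) by fastforce
    show "positive \<F> (\<Union>n\<in>{N..}. Y n)" for N
    proof -
      have "Z N n \<subseteq> Y (n + N)" for n
        unfolding Y_def by (rule SUP_upper2[of N]) auto
      then have "(\<Union>n. Z N n) \<subseteq> (\<Union>n\<in>{N..}. Y n)" by fastforce
      then show ?thesis by (rule positive_mono[OF Z(3)])
    qed
  qed
qed

section \<open>Mathias forcing\<close>

lemma mathias_extend:
  assumes "filter_on_omega \<F>" "(s, A) \<in> mathias \<F>" "finite t" "t \<subseteq> A" "G \<in> \<F>" "G \<subseteq> A"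
  shows "(s \<union> t, {j \<in> G. \<forall>i\<in>s \<union> t. i < j}) \<in> mathias \<F>"
    and "mathias_le (s \<union> t, {j \<in> G. \<forall>i\<in>s \<union> t. i < j}) (s, A)"
proof -
  have "finite (s \<union> t)" using assms(2,3) unfolding mathias_def by blast
  then show "(s \<union> t, {j \<in> G. \<forall>i\<in>s \<union> t. i < j}) \<in> mathias \<F>"
    using filter_above[OF assms(1,5)] unfolding mathias_def by blast
  show "mathias_le (s \<union> t, {j \<in> G. \<forall>i\<in>s \<union> t. i < j}) (s, A)"
    using assms(2,4,6) unfolding mathias_def mathias_le_def end_extension_def by auto
qed

lemma mathias_leD:
  assumes "mathias_le (s, A) (t, B)"
  shows "A \<subseteq> B" "t \<subseteq> s" "s \<union> A \<subseteq> t \<union> B" "s - t \<subseteq> B"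
  using assms unfolding mathias_le_def end_extension_def by auto

lemma adds_dominating_real_if_not_positive_selection:
  assumes \<F>: "filter_on_omega \<F>" and nsel: "\<not> positive_selection \<F>"
  shows "forcing_notion.adds_dominating_real (mathias \<F>) mathias_le ({}, UNIV)"
proof -
  interpret forcing_notion "mathias \<F>" mathias_le "({}, UNIV)"
    by (rule forcing_notion_mathias[OF \<F>])
  obtain X :: "nat \<Rightarrow> nat set set" where X: "\<And>n. X n \<subseteq> Collect finite" "\<And>n. positive \<F> (X n)"
    and nX: "\<And>Y. (\<forall>n. finite (Y n) \<and> Y n \<subseteq> X n) \<Longrightarrow> \<not> positive \<F> (\<Union>n. Y n)"
    using nsel unfolding positive_selection_def by blast
  \<comment> \<open>\<open>(s, A)\<close> decides that \<open>m\<close> is the least code of a member of \<open>X n\<close> included in the generic set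
    without its elements below \<open>n\<close>.\<close>
  define D where "D n m = (\<lambda>(s, A). set_decode m \<in> X n \<and> set_decode m \<subseteq> s - {..<n} \<and>
    (\<forall>k<m. set_decode k \<in> X n \<longrightarrow> \<not> set_decode k \<subseteq> s \<union> A - {..<n}))" for n m
  have down: "D n m r" if "D n m q" "mathias_le r q" for n m q r
  proof -
    obtain s A where q: "q = (s, A)" by (rule prod.exhaust)
    obtain t B where r: "r = (t, B)" by (rule prod.exhaust)
    note le = mathias_leD[OF that(2)[unfolded q r]]
    have "t \<union> B - {..<n} \<subseteq> s \<union> A - {..<n}" using le(3) by blast
    then have "set_decode k \<subseteq> s \<union> A - {..<n}" if "set_decode k \<subseteq> t \<union> B - {..<n}" for k
      using that by (rule subset_trans[rotated])
    then show ?thesis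
      using that(1) le(2) unfolding D_def q r prod.case by blast
  qed
  have unique: "m = l" if "D n m q" "D n l q" for n m l q
  proof -
    have False if "D n m q" "D n l q" "l < m" for m l
      using that unfolding D_def by (cases q) auto
    then show ?thesis using that by (metis linorder_neqE_nat)
  qed
  have dense: "\<exists>r\<in>mathias \<F>. mathias_le r q \<and> (\<exists>m. D n m r)" if q: "q \<in> mathias \<F>" for q n
  proof -
    define C where "C m \<longleftrightarrow> (\<exists>s A. (s, A) \<in> mathias \<F> \<and> mathias_le (s, A) q \<and>
      set_decode m \<in> X n \<and> set_decode m \<subseteq> s - {..<n})" for m
    have step: "C m" if sA: "(s, A) \<in> mathias \<F>" "mathias_le (s, A) q"
      and m: "set_decode m \<in> X n" "set_decode m \<subseteq> s \<union> A - {..<n}" for s A m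
    proof -
      let ?t = "set_decode m \<inter> A"
      have A: "A \<in> \<F>" using sA unfolding mathias_def by blast
      note ext = mathias_extend[OF \<F> sA(1) _ _ A subset_refl, of ?t]
      have "mathias_le (s \<union> ?t, {j \<in> A. \<forall>i\<in>s \<union> ?t. i < j}) q"
        using ext q sA le_trans by (meson finite_Int finite_set_decode inf_le2)
      moreover have "set_decode m \<subseteq> s \<union> ?t - {..<n}" using m by blast
      ultimately show ?thesis
        using ext(1) m(1) unfolding C_def by (meson finite_Int finite_set_decode inf_le2)
    qed
    have "\<exists>m. C m"
    proof -
      obtain s A where sA: "q = (s, A)" "A \<in> \<F>" using q unfolding mathias_def by blast
      obtain t where t: "t \<in> X n" "t \<subseteq> {j \<in> A. \<forall>i\<in>{..<n}. i < j}"
        using X(2)[of n] filter_above[OF \<F> sA(2), of "{..<n}"] unfolding positive_def by blast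
      have "finite t" using X(1) t(1) by blast
      then have "set_decode (set_encode t) = t" by simp
      moreover have "t \<subseteq> s \<union> A - {..<n}" using t(2) by fastforce
      ultimately show ?thesis
        using step[of s A "set_encode t"] q sA t le_refl by metis
    qed
    \<comment> \<open>The least value that some extension of \<open>q\<close> allows is decided by such an extension.\<close>
    then have "C (LEAST m. C m)" by (rule LeastI_ex)
    then obtain s A where sA: "(s, A) \<in> mathias \<F>" "mathias_le (s, A) q"
      "set_decode (LEAST m. C m) \<in> X n" "set_decode (LEAST m. C m) \<subseteq> s - {..<n}"
      unfolding C_def by blast
    moreover have "\<not> set_decode k \<subseteq> s \<union> A - {..<n}"
      if "k < (LEAST m. C m)" "set_decode k \<in> X n" for k
      using step[OF sA(1,2) that(2)] not_less_Least[OF that(1)] by blast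
    ultimately have "D n (LEAST m. C m) (s, A)" unfolding D_def by simp
    then show ?thesis using sA by blast
  qed
  have dec: "decision_relation ({}, UNIV) D"
    unfolding decision_relation_def dense_below_def
    by (intro conjI allI ballI impI; (erule (1) down | erule (1) unique | erule dense))
  have "decides_dominating ({}, UNIV) D"
    unfolding decides_dominating_def
  proof
    fix a :: "nat \<Rightarrow> nat"
    define Y where "Y n = X n \<inter> set_decode ` {..<a n}" for n
    have "\<not> positive \<F> (\<Union>n. Y n)" by (rule nX) (auto simp: Y_def)
    then obtain B where B: "B \<in> \<F>" "\<forall>t\<in>\<Union>n. Y n. \<not> t \<subseteq> B"
      unfolding positive_def by (metis (no_types))
    show "dense_below ({}, UNIV)
      (\<lambda>q. \<exists>N. \<forall>n\<ge>N. dense_below q (\<lambda>r. \<exists>m\<ge>a n. D n m r))"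
      unfolding dense_below_def[of "({}, UNIV)"]
    proof (intro ballI impI)
      fix q assume q: "q \<in> mathias \<F>"
      obtain s A where sA: "q = (s, A)" "A \<in> \<F>" "finite s" using q unfolding mathias_def by blast
      define q' where "q' = (s, {j \<in> A \<inter> B. \<forall>i\<in>s. i < j})"
      have AB: "A \<inter> B \<in> \<F>" by (rule filter_Int[OF \<F> sA(2) B(1)])
      have q': "q' \<in> mathias \<F>" "mathias_le q' q"
        using mathias_extend[OF \<F> q[unfolded sA] _ _ AB, of "{}"] unfolding q'_def sA by simp_all
      obtain N where N: "\<And>i. i \<in> s \<Longrightarrow> i < N"
        using sA(3) finite_nat_set_iff_bounded[of s] by auto
      have "dense_below q' (\<lambda>r. \<exists>m\<ge>a n. D n m r)" if n: "n \<ge> N" for n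
        unfolding dense_below_def
      proof (intro ballI impI)
        fix r assume r: "r \<in> mathias \<F>" "mathias_le r q'"
        obtain r' m where r': "r' \<in> mathias \<F>" "mathias_le r' r" "D n m r'"
          using dense[OF r(1)] by blast
        obtain u G where uG: "r' = (u, G)" by (rule prod.exhaust)
        have "mathias_le (u, G) q'" 
          using le_trans[OF r'(1) r(1) q'(1) r'(2) r(2)] unfolding uG .
        then have "u - {..<n} \<subseteq> B"
          using mathias_leD(4)[of u G s] N n unfolding q'_def by fastforce
        moreover have "set_decode m \<in> X n" "set_decode m \<subseteq> u - {..<n}"
          using r'(3) unfolding D_def uG by auto
        ultimately have "set_decode m \<notin> Y n" using B(2) by blast
        then have "m \<ge> a n" using \<open>set_decode m \<in> X n\<close> unfolding Y_def by auto
        then show "\<exists>r'\<in>mathias \<F>. mathias_le r' r \<and> (\<exists>m\<ge>a n. D n m r')" using r' by blast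
      qed
      then show "\<exists>r\<in>mathias \<F>. mathias_le r q \<and>
        (\<exists>N. \<forall>n\<ge>N. dense_below r (\<lambda>r. \<exists>m\<ge>a n. D n m r))"
        using q' by blast
    qed
  qed
  then show ?thesis using dec one_mem adds_dominating_real_iff by blast
qed

text \<open>
  The finite sets \<open>t\<close> for which some condition with stem \<open>s \<union> t\<close> decides the value at \<open>n\<close> form a
  positive family, because every condition below \<open>p\<close> with stem \<open>s\<close> has an extension that decides it.
  If \<open>t \<subseteq> A\<close>, then such a condition is compatible with \<open>(s, A)\<close>, so these values cannot be avoided by
  shrinking \<open>A\<close>. Selecting finitely many \<open>t\<close> for each argument makes them bounded.
\<close>

lemma stem_bound:
  assumes \<F>: "filter_on_omega \<F>" and sel: "positive_selection \<F>"
    and p: "p \<in> mathias \<F>"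
    and dense: "\<And>q n. q \<in> mathias \<F> \<Longrightarrow> mathias_le q p \<Longrightarrow>
      \<exists>r\<in>mathias \<F>. mathias_le r q \<and> (\<exists>m. D n m r)"
  shows "\<exists>g :: nat \<Rightarrow> nat. \<forall>A N. (s, A) \<in> mathias \<F> \<longrightarrow> mathias_le (s, A) p \<longrightarrow>
    (\<exists>n\<ge>N. \<exists>t\<subseteq>A. finite t \<and> (\<exists>G m. (s \<union> t, G) \<in> mathias \<F> \<and> D n m (s \<union> t, G) \<and> m < g n))"
proof (cases "\<exists>A. (s, A) \<in> mathias \<F> \<and> mathias_le (s, A) p")
  case False
  then show ?thesis by blast
next
  case True
  interpret forcing_notion "mathias \<F>" mathias_le "({}, UNIV)"
    by (rule forcing_notion_mathias[OF \<F>])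
  obtain A where A: "(s, A) \<in> mathias \<F>" "mathias_le (s, A) p" using True by blast
  define X where "X n = {t. finite t \<and> (\<exists>G m. (s \<union> t, G) \<in> mathias \<F> \<and> D n m (s \<union> t, G))}" for n
  have pos: "positive \<F> (X n)" for n
    unfolding positive_def
  proof
    fix B assume "B \<in> \<F>"
    then have AB: "A \<inter> B \<in> \<F>" using A(1) filter_Int[OF \<F>] unfolding mathias_def by blast
    let ?q = "(s, {j \<in> A \<inter> B. \<forall>i\<in>s. i < j})"
    have q: "?q \<in> mathias \<F>" "mathias_le ?q (s, A)"
      using mathias_extend[OF \<F> A(1) _ _ AB, of "{}"] by simp_all
    have "mathias_le ?q p" by (rule le_trans[OF q(1) A(1) p q(2) A(2)])
    from dense[OF q(1) this, of n] obtain r m where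
      "r \<in> mathias \<F>" "mathias_le r ?q" "D n m r" by (elim bexE conjE exE)
    moreover obtain u G where "r = (u, G)" by (rule prod.exhaust)
    ultimately have r: "(u, G) \<in> mathias \<F>" "mathias_le (u, G) ?q" "D n m (u, G)" by simp_all
    have "s \<union> (u - s) = u" "u - s \<subseteq> B" using mathias_leD[OF r(2)] by auto
    moreover have "finite (u - s)" using r(1) unfolding mathias_def by blast
    ultimately have "u - s \<in> X n" using r unfolding X_def by auto
    then show "\<exists>t\<in>X n. t \<subseteq> B" using \<open>u - s \<subseteq> B\<close> by blast
  qed
  moreover have "X n \<subseteq> Collect finite" for n unfolding X_def by blast
  ultimately obtain Y where Y: "\<And>n. finite (Y n)" "\<And>n. Y n \<subseteq> X n" "\<And>N. positive \<F> (\<Union>n\<in>{N..}. Y n)"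
    using positive_selection_tails[OF sel, of X] by metis
  define v where "v n t = (SOME m. \<exists>G. (s \<union> t, G) \<in> mathias \<F> \<and> D n m (s \<union> t, G))" for n t
  have v: "\<exists>G. (s \<union> t, G) \<in> mathias \<F> \<and> D n (v n t) (s \<union> t, G)" if "t \<in> X n" for n t
    unfolding v_def by (rule someI_ex) (use that X_def in blast)
  define g where "g n = Suc (\<Sum>t\<in>Y n. v n t)" for n
  have g: "v n t < g n" if "t \<in> Y n" for n t
    using member_le_sum[of t "Y n" "v n"] that Y(1) unfolding g_def by (simp add: less_Suc_eq_le)
  have "\<exists>n\<ge>N. \<exists>t\<subseteq>B. finite t \<and> (\<exists>G m. (s \<union> t, G) \<in> mathias \<F> \<and> D n m (s \<union> t, G) \<and> m < g n)"
    if B: "(s, B) \<in> mathias \<F>" for B N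
  proof -
    have "B \<in> \<F>" using B unfolding mathias_def by blast
    then obtain n t where t: "n \<ge> N" "t \<in> Y n" "t \<subseteq> B" using Y(3)[of N] unfolding positive_def by blast
    moreover have "t \<in> X n" "finite t" using t Y(2) unfolding X_def by blast+
    ultimately show ?thesis using v g by meson
  qed
  then show ?thesis by blast
qed

lemma countably_many_functions_eventually_bounded:
  fixes h :: "nat \<Rightarrow> nat \<Rightarrow> nat"
  obtains f where "\<And>i n. n \<ge> i \<Longrightarrow> h i n \<le> f n"
proof
  show "h i n \<le> (\<Sum>i\<le>n. h i n)" if "n \<ge> i" for i n
    using that by (intro member_le_sum) auto
qed

lemma not_adds_dominating_real_if_positive_selection:
  assumes \<F>: "filter_on_omega \<F>" and sel: "positive_selection \<F>"
  shows "\<not> forcing_notion.adds_dominating_real (mathias \<F>) mathias_le ({}, UNIV)"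
proof
  interpret forcing_notion "mathias \<F>" mathias_le "({}, UNIV)"
    by (rule forcing_notion_mathias[OF \<F>])
  assume adds_dominating_real
  then obtain p D where p: "p \<in> mathias \<F>" and D: "decision_relation p D"
    and dom: "decides_dominating p D"
    using adds_dominating_real_iff by blast
  have dense: "\<exists>r\<in>mathias \<F>. mathias_le r q \<and> (\<exists>m. D n m r)"
    if "q \<in> mathias \<F>" "mathias_le q p" for q n
    using D that unfolding decision_relation_def dense_below_def by blast
  have "\<forall>s. \<exists>g :: nat \<Rightarrow> nat. \<forall>A N. (s, A) \<in> mathias \<F> \<longrightarrow> mathias_le (s, A) p \<longrightarrow>
    (\<exists>n\<ge>N. \<exists>t\<subseteq>A. finite t \<and> (\<exists>G m. (s \<union> t, G) \<in> mathias \<F> \<and> D n m (s \<union> t, G) \<and> m < g n))"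
    by (intro allI stem_bound[OF \<F> sel p] dense)
  from choice[OF this] obtain h where
    h: "\<forall>s A N. (s, A) \<in> mathias \<F> \<longrightarrow> mathias_le (s, A) p \<longrightarrow>
      (\<exists>n\<ge>N. \<exists>t\<subseteq>A. finite t \<and> (\<exists>G m. (s \<union> t, G) \<in> mathias \<F> \<and> D n m (s \<union> t, G) \<and> m < h s n))" ..
  obtain f where f: "\<And>i n. n \<ge> i \<Longrightarrow> h (set_decode i) n \<le> f n"
    using countably_many_functions_eventually_bounded[of "\<lambda>i. h (set_decode i)"] by metis
  have "dense_below p (\<lambda>q. \<exists>N. \<forall>n\<ge>N. dense_below q (\<lambda>r. \<exists>m\<ge>f n. D n m r))"
    using dom unfolding decides_dominating_def by (rule spec)
  then obtain q0 N where q0: "q0 \<in> mathias \<F>" "mathias_le q0 p"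
    and N0: "\<forall>n\<ge>N. dense_below q0 (\<lambda>r. \<exists>m\<ge>f n. D n m r)"
    using p le_refl[OF p] unfolding dense_below_def[of p] by blast
  obtain s A where "q0 = (s, A)" by (rule prod.exhaust)
  then have sA: "(s, A) \<in> mathias \<F>" "mathias_le (s, A) p"
    and N: "\<And>n. n \<ge> N \<Longrightarrow> dense_below (s, A) (\<lambda>r. \<exists>m\<ge>f n. D n m r)"
    using q0 N0 by simp_all
  have fin: "finite s" and "A \<in> \<F>" using sA unfolding mathias_def by blast+
  obtain n t G m where n: "n \<ge> max N (set_encode s)" and t: "t \<subseteq> A" "finite t"
    and G: "(s \<union> t, G) \<in> mathias \<F>" "D n m (s \<union> t, G)" "m < h s n"
    using h[rule_format, OF sA, of "max N (set_encode s)"] by blast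
  have "h s n \<le> f n" using f[of "set_encode s" n] n fin by simp
  \<comment> \<open>A common extension of \<open>(s, A)\<close> and \<open>(s \<union> t, G)\<close>.\<close>
  define q where "q = (s \<union> t, {j \<in> A \<inter> G. \<forall>i\<in>s \<union> t. i < j})"
  have "A \<inter> G \<in> \<F>" using filter_Int[OF \<F> \<open>A \<in> \<F>\<close>] G(1) unfolding mathias_def by blast
  then have q: "q \<in> mathias \<F>" "mathias_le q (s, A)"
    using mathias_extend[OF \<F> sA(1) t(2,1)] unfolding q_def by blast+
  have qG: "mathias_le q (s \<union> t, G)"
    unfolding q_def mathias_le_def end_extension_def by auto
  obtain r l where r: "r \<in> mathias \<F>" "mathias_le r q" "l \<ge> f n" "D n l r"
    using N[of n] n q unfolding dense_below_def by auto
  have "mathias_le r (s \<union> t, G)" using r q qG G le_trans by blast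
  then have "D n m r" using D r G unfolding decision_relation_def by blast
  moreover have "mathias_le r p" using r q sA p le_trans by meson
  ultimately have "m = l" using D r unfolding decision_relation_def by blast
  then show False using G(3) \<open>h s n \<le> f n\<close> r(3) by simp
qed

theorem theorem1p1:
  fixes \<F> :: "nat set set"
  assumes "filter_on_omega \<F>"
  shows "\<not> forcing_notion.adds_dominating_real (mathias \<F>) mathias_le ({}, UNIV) \<longleftrightarrow>
         menger_space (subtopology powerset_omega \<F>)"
  using menger_space_iff_positive_selection[OF assms]
    adds_dominating_real_if_not_positive_selection[OF assms]
    not_adds_dominating_real_if_positive_selection[OF assms]
  by blast

end
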